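(* Let $J\ge 3$ and let $A$ be the square matrix of dimension $J-1$ with $A_{i,i}=1$ for $1\le i\le J-1$, $A_{i,i-1}=-1$ for $2\le i\le J-1$, and all other entries $0$. Then, for every design matrix $Z\in\mathfrak{Z}$, the following two models are equal: $$(\text{cumulative},\ \text{exponential},\ Z)=(\text{sequential},\ \text{exponential},\ AZ).$$
   Context: Setting. Let $J\ge 3$ (number of categories), $p\ge 1$, and let $\mathcal{X}\subseteq\mathbb{R}^p$ be the nonempty set of values of the explanatory vector $x$. Let $\mathcal{M}=\{\pi\in\,]0,1[^{J-1} : \sum_{j=1}^{J-1}\pi_j<1\}$; for $\pi\in\mathcal{M}$ put $\pi_J=1-\sum_{j=1}^{J-1}\pi_j$ ($\pi_j$ is the probability of category $j$). Ratios. The cumulative ratio $r:\mathcal{M}\to\,]0,1[^{J-1}$ is $r_j(\pi)=\pi_1+\dots+\pi_j$; the sequential ratio is $r_j(\pi)=\pi_j/(\pi_j+\dots+\pi_J)$, for $j=1,\dots,J-1$. Each is injective on $\mathcal{M}$. Cdf. The exponential cdf is $F(w)=1-e^{-w}$, used on the open interval $I_F=\,]0,+\infty[$, which it maps bijectively onto $]0,1[$. Design matrices. The complete design matrix $Z_c(x)$ is the $(J-1)\times(J-1)(1+p)$ matrix with $Z_c(x)\beta=(\alpha_j+x^t\delta_j)_{j=1,\dots,J-1}$ for $\beta=(\alpha_1,\dots,\alpha_{J-1},\delta_1^t,\dots,\delta_{J-1}^t)^t$, $\alpha_j\in\mathbb{R}$, $\delta_j\in\mathbb{R}^p$. The set $\mathfrak{Z}$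 of design matrices consists of all matrix functions $Z:x\mapsto Z_c(x)C$, where $C$ is a constant real matrix of full column rank with $q$ columns, $J-1+p\le q\le (J-1)(1+p)$. For a constant matrix $M$ of dimension $J-1$, $MZ$ denotes $x\mapsto MZ(x)$. Models. A model $(r,F,Z)$, with $Z$ having $q$ columns, has as parameter space the set of $\beta\in\mathbb{R}^q$ such that for all $x\in\mathcal{X}$, $\eta=Z(x)\beta$ satisfies $\eta\in I_F^{J-1}$ and $(F(\eta_1),\dots,F(\eta_{J-1}))\in r(\mathcal{M})$. For such $\beta$ and $x\in\mathcal{X}$, it defines the unique $\pi=\pi(x;\beta)\in\mathcal{M}$ with $r(\pi)=(F(\eta_1),\dots,F(\eta_{J-1}))^t$, $\eta=Z(x)\beta$. Two models are equal if they have the same parameter space and give the same $\pi(x;\beta)$ for all $x\in\mathcal{X}$ and all $\beta$ in it. *)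

theory Defs
  imports Complex_Main "Jordan_Normal_Form.Matrix" "Jordan_Normal_Form.DL_Rank"
begin

(* Vectors and matrices are 0-based: category j of the paper is index j - 1 here, so the
   J categories are 0, ..., J - 1 and vectors of dimension J - 1 have indices 0, ..., J - 2. *)

definition prob_simplex :: "nat \<Rightarrow> real vec set" where
  "prob_simplex J = {\<pi> \<in> carrier_vec (J - 1).
     (\<forall>j<J-1. 0 < \<pi> $ j \<and> \<pi> $ j < 1) \<and> (\<Sum>j<J-1. \<pi> $ j) < 1}"

text \<open>The last category, of index \<open>J - 1\<close>, receives the remaining mass.\<close>

definition cat_prob :: "nat \<Rightarrow> real vec \<Rightarrow> nat \<Rightarrow> real" where
  "cat_prob J \<pi> j = (if j < J - 1 then \<pi> $ j else 1 - (\<Sum>k<J-1. \<pi> $ k))"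

definition cumulative_ratio :: "nat \<Rightarrow> real vec \<Rightarrow> real vec" where
  "cumulative_ratio J \<pi> = vec (J - 1) (\<lambda>j. \<Sum>k\<le>j. cat_prob J \<pi> k)"

definition sequential_ratio :: "nat \<Rightarrow> real vec \<Rightarrow> real vec" where
  "sequential_ratio J \<pi> = vec (J - 1) (\<lambda>j. cat_prob J \<pi> j / (\<Sum>k=j..<J. cat_prob J \<pi> k))"

text \<open>A cdf \<open>F\<close> comes with the open interval \<open>I\<^sub>F\<close> on which it is used.\<close>

type_synonym cdf_on = "(real \<Rightarrow> real) \<times> real set"

definition exponential :: cdf_on where
  "exponential = (\<lambda>w. 1 - exp (- w), {0<..})"

text \<open>The parameter vector is
  \<open>\<beta> = (\<alpha>\<^sub>0, \<dots>, \<alpha>\<^bsub>J-2\<^esub>, \<delta>\<^sub>0, \<dots>, \<delta>\<^bsub>J-2\<^esub>)\<close> with blocks \<open>\<delta>\<^sub>j\<close> of length \<open>p\<close>; so entry \<open>l\<close> of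
  \<open>\<delta>\<^sub>j\<close> is entry \<open>(J - 1) + j * p + l\<close> of \<open>\<beta>\<close>.
  The lemma \<open>complete_design_mult\<close> below gives the resulting linear predictors.\<close>

definition complete_design :: "nat \<Rightarrow> nat \<Rightarrow> real vec \<Rightarrow> real mat" where
  "complete_design J p x = mat (J - 1) ((J - 1) * (1 + p)) (\<lambda>(j, k).
     if k < J - 1 then (if k = j then 1 else 0)
     else (if (k - (J - 1)) div p = j then x $ ((k - (J - 1)) mod p) else 0))"

text \<open>Members of the set of design matrices that have \<open>q\<close> columns. A design matrix is a
  function on the set \<open>X\<close> of values of the explanatory vector; its HOL values outside \<open>X\<close> are
  irrelevant.\<close>

definition design_matrices :: "nat \<Rightarrow> nat \<Rightarrow> real vec set \<Rightarrow> nat \<Rightarrow> (real vec \<Rightarrow> real mat) set" where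
  "design_matrices J p X q = {Z.
     J - 1 + p \<le> q \<and> q \<le> (J - 1) * (1 + p) \<and>
     (\<exists>C \<in> carrier_mat ((J - 1) * (1 + p)) q.
        vec_space.rank ((J - 1) * (1 + p)) C = q \<and>
        (\<forall>x\<in>X. Z x = complete_design J p x * C))}"

record reg_model =
  ratio :: "real vec \<Rightarrow> real vec"
  cdf_fn :: cdf_on
  design :: "real vec \<Rightarrow> real mat"
  num_cols :: nat

definition in_range :: "nat \<Rightarrow> reg_model \<Rightarrow> real vec \<Rightarrow> bool" where
  "in_range J m \<eta> \<longleftrightarrow>
     (\<forall>j<J-1. \<eta> $ j \<in> snd (cdf_fn m)) \<and>
     map_vec (fst (cdf_fn m)) \<eta> \<in> ratio m ` prob_simplex J"

definition param_space :: "nat \<Rightarrow> real vec set \<Rightarrow> reg_model \<Rightarrow> real vec set" where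
  "param_space J X m =
     {\<beta> \<in> carrier_vec (num_cols m). \<forall>x\<in>X. in_range J m (design m x *\<^sub>v \<beta>)}"

text \<open>On the parameter space the description is proper for both ratios, by
  \<open>inj_on_cumulative_ratio\<close> and \<open>inj_on_sequential_ratio\<close>.\<close>

definition model_prob :: "nat \<Rightarrow> reg_model \<Rightarrow> real vec \<Rightarrow> real vec \<Rightarrow> real vec" where
  "model_prob J m x \<beta> = (THE \<pi>. \<pi> \<in> prob_simplex J \<and>
     ratio m \<pi> = map_vec (fst (cdf_fn m)) (design m x *\<^sub>v \<beta>))"

definition models_equal :: "nat \<Rightarrow> real vec set \<Rightarrow> reg_model \<Rightarrow> reg_model \<Rightarrow> bool" where
  "models_equal J X m m' \<longleftrightarrow>
     param_space J X m = param_space J X m' \<and>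
     (\<forall>x\<in>X. \<forall>\<beta>\<in>param_space J X m. model_prob J m x \<beta> = model_prob J m' x \<beta>)"

definition diff_mat :: "nat \<Rightarrow> real mat" where
  "diff_mat J = mat (J - 1) (J - 1) (\<lambda>(i, k).
     if k = i then 1 else if i = Suc k then - 1 else 0)"

lemma complete_design_mult:
  assumes "\<beta> \<in> carrier_vec ((J - 1) * (1 + p))" "j < J - 1"
  shows "(complete_design J p x *\<^sub>v \<beta>) $ j
       = \<beta> $ j + (\<Sum>l<p. x $ l * \<beta> $ ((J - 1) + j * p + l))"
proof -
  define n where "n = J - 1"
  define g where "g k = complete_design J p x $$ (j, k) * \<beta> $ k" for k
  have j: "j < n" using assms n_def by simp
  have split: "{..<n * (1 + p)} = {..<n} \<union> (+) n ` {..<n * p}"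
  proof (intro equalityI subsetI)
    fix k assume k: "k \<in> {..<n * (1 + p)}"
    show "k \<in> {..<n} \<union> (+) n ` {..<n * p}"
    proof (cases "k < n")
      case False
      then have "k = n + (k - n)" "k - n < n * p" using k by auto
      then show ?thesis by blast
    qed simp
  qed auto
  have "(complete_design J p x *\<^sub>v \<beta>) $ j = (\<Sum>k<n * (1 + p). g k)"
    using assms j unfolding g_def n_def
    by (auto simp: complete_design_def scalar_prod_def atLeast0LessThan intro!: sum.cong)
  also have "\<dots> = (\<Sum>k<n. g k) + (\<Sum>k\<in>(+) n ` {..<n * p}. g k)"
    unfolding split by (rule sum.union_disjoint) auto
  also have "(\<Sum>k<n. g k) = (\<Sum>k<n. if k = j then \<beta> $ j else 0)"
    using j by (intro sum.cong) (auto simp: g_def complete_design_def n_def)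
  also have "\<dots> = \<beta> $ j" using j by simp
  also have "(\<Sum>k\<in>(+) n ` {..<n * p}. g k) = (\<Sum>i<n * p. g (n + i))"
    by (simp add: sum.reindex)
  also have "\<dots> = (\<Sum>i<n * p. if i div p = j then x $ (i mod p) * \<beta> $ (n + i) else 0)"
    using j by (intro sum.cong) (auto simp: g_def complete_design_def n_def)
  also have "\<dots> = (\<Sum>i\<in>{i. i < n * p \<and> i div p = j}. x $ (i mod p) * \<beta> $ (n + i))"
    by (subst sum.inter_filter[symmetric]) (auto intro: sum.cong)
  also have "{i. i < n * p \<and> i div p = j} = (\<lambda>l. j * p + l) ` {..<p}"
  proof (intro equalityI subsetI)
    fix i assume i: "i \<in> {i. i < n * p \<and> i div p = j}"
    then have "p > 0" by (cases p) auto
    then have "i = j * p + i mod p" "i mod p < p" using i by auto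
    then show "i \<in> (\<lambda>l. j * p + l) ` {..<p}" by blast
  next
    fix i assume "i \<in> (\<lambda>l. j * p + l) ` {..<p}"
    then obtain l where l: "i = j * p + l" "l < p" by auto
    have "Suc j * p \<le> n * p" using j by (intro mult_le_mono1) simp
    then show "i \<in> {i. i < n * p \<and> i div p = j}" using l by simp
  qed
  also have "(\<Sum>i\<in>(\<lambda>l. j * p + l) ` {..<p}. x $ (i mod p) * \<beta> $ (n + i))
           = (\<Sum>l<p. x $ l * \<beta> $ (n + j * p + l))"
    by (simp add: sum.reindex inj_on_def add.assoc)
  finally show ?thesis by (simp add: n_def)
qed

lemma sum_cat_prob: "J > 0 \<Longrightarrow> (\<Sum>k<J. cat_prob J \<pi> k) = 1"
  by (cases J) (simp_all add: cat_prob_def)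

lemma inj_on_cumulative_ratio: "inj_on (cumulative_ratio J) (prob_simplex J)"
proof (rule inj_onI)
  fix \<pi> \<rho>
  assume mem: "\<pi> \<in> prob_simplex J" "\<rho> \<in> prob_simplex J"
    and eq: "cumulative_ratio J \<pi> = cumulative_ratio J \<rho>"
  have cum: "(\<Sum>k\<le>j. cat_prob J \<pi> k) = (\<Sum>k\<le>j. cat_prob J \<rho> k)" if "j < J - 1" for j
    using arg_cong[OF eq, of "\<lambda>v. v $ j"] that by (simp add: cumulative_ratio_def)
  have "cat_prob J \<pi> j = cat_prob J \<rho> j" if "j < J - 1" for j
    using cum[of j] cum[of "j - 1"] that by (cases j) auto
  then show "\<pi> = \<rho>" using mem by (intro eq_vecI) (auto simp: prob_simplex_def cat_prob_def)
qed

lemma inj_on_sequential_ratio: "inj_on (sequential_ratio J) (prob_simplex J)"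
proof (rule inj_onI)
  fix \<pi> \<rho>
  assume mem: "\<pi> \<in> prob_simplex J" "\<rho> \<in> prob_simplex J"
    and eq: "sequential_ratio J \<pi> = sequential_ratio J \<rho>"
  have tail: "(\<Sum>k=j..<J. cat_prob J \<sigma> k) = 1 - (\<Sum>k<j. cat_prob J \<sigma> k)" if "j < J" for j \<sigma>
    using sum_cat_prob[of J \<sigma>] that
      sum.atLeastLessThan_concat[of 0 j J "cat_prob J \<sigma>"] by (simp add: atLeast0LessThan)
  have pos: "(\<Sum>k=j..<J. cat_prob J \<sigma> k) > 0" if "\<sigma> \<in> prob_simplex J" "j < J" for j \<sigma>
    using that by (intro sum_pos) (auto simp: prob_simplex_def cat_prob_def)
  have "cat_prob J \<pi> j = cat_prob J \<rho> j" if "j < J - 1" for j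
    using that
  proof (induction j rule: less_induct)
    case (less j)
    have "(\<Sum>k<j. cat_prob J \<pi> k) = (\<Sum>k<j. cat_prob J \<rho> k)"
      using less by (intro sum.cong) auto
    then have "(\<Sum>k=j..<J. cat_prob J \<pi> k) = (\<Sum>k=j..<J. cat_prob J \<rho> k)"
      using less.prems tail[of j] by simp
    moreover have "cat_prob J \<pi> j / (\<Sum>k=j..<J. cat_prob J \<pi> k)
                 = cat_prob J \<rho> j / (\<Sum>k=j..<J. cat_prob J \<rho> k)"
      using arg_cong[OF eq, of "\<lambda>v. v $ j"] less.prems by (simp add: sequential_ratio_def)
    moreover have "(\<Sum>k=j..<J. cat_prob J \<rho> k) > 0"
      using pos[OF mem(2), of j] less.prems by simp
    ultimately show ?case by simp
  qed
  then show "\<pi> = \<rho>" using mem by (intro eq_vecI) (auto simp: prob_simplex_def cat_prob_def)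
qed

end

(* With S_j the total probability of the categories from j on (0-based, so S_0 = 1), the
   cumulative ratio is 1 - S_(j+1) and the sequential ratio is 1 - S_(j+1) / S_j.  As
   1 - F(w) = exp (-w), the cumulative model says S_(j+1) = exp (-eta_j) and the sequential one
   with predictor A eta says S_(j+1) / S_j = exp (-eta_j) / exp (-eta_(j-1)); these agree by
   telescoping. *)

theory Submission
  imports Defs
begin

text \<open>This is S_j of the telescoping argument. The sum runs up to index \<open>J - 1\<close>,
  so it includes the category that receives the remaining mass.\<close>

definition tail_prob :: "nat \<Rightarrow> real vec \<Rightarrow> nat \<Rightarrow> real" where
  "tail_prob J \<pi> j = (\<Sum>k=j..<J. cat_prob J \<pi> k)"

text \<open>The index is unrestricted because \<open>cat_prob\<close> assigns the remaining mass,
  which is positive, to every index from \<open>J - 1\<close> on.\<close>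

lemma cat_prob_pos: "\<pi> \<in> prob_simplex J \<Longrightarrow> 0 < cat_prob J \<pi> j"
  by (auto simp: prob_simplex_def cat_prob_def)

lemma tail_prob_pos: "\<pi> \<in> prob_simplex J \<Longrightarrow> j < J \<Longrightarrow> 0 < tail_prob J \<pi> j"
  unfolding tail_prob_def by (intro sum_pos) (auto intro: cat_prob_pos)

lemma tail_prob_0: "0 < J \<Longrightarrow> tail_prob J \<pi> 0 = 1"
  using sum_cat_prob[of J \<pi>] by (simp add: tail_prob_def atLeast0LessThan)

lemma tail_prob_Suc: "j < J \<Longrightarrow> tail_prob J \<pi> j = cat_prob J \<pi> j + tail_prob J \<pi> (Suc j)"
  by (simp add: tail_prob_def sum.atLeast_Suc_lessThan)

lemma cumulative_ratio_tail:
  assumes "j < J - 1"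
  shows "cumulative_ratio J \<pi> $ j = 1 - tail_prob J \<pi> (Suc j)"
proof -
  \<comment> \<open>The base case is S_0 = 1; each further step moves one category from the tail
    into the sum.\<close>
  have "(\<Sum>k\<le>i. cat_prob J \<pi> k) = 1 - tail_prob J \<pi> (Suc i)" if "i < J" for i
    using that
    by (induction i) (use tail_prob_0[of J \<pi>] tail_prob_Suc[of _ J \<pi>] in auto)
  with assms show ?thesis by (simp add: cumulative_ratio_def)
qed

text \<open>On the simplex S_j is positive, so (S_j - S_(j+1)) / S_j splits with first term
  1.\<close>

lemma sequential_ratio_tail:
  assumes "\<pi> \<in> prob_simplex J" "j < J - 1"
  shows "sequential_ratio J \<pi> $ j = 1 - tail_prob J \<pi> (Suc j) / tail_prob J \<pi> j"
proof -
  have "sequential_ratio J \<pi> $ j = cat_prob J \<pi> j / tail_prob J \<pi> j"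
    using assms by (simp add: sequential_ratio_def tail_prob_def)
  moreover have "0 < tail_prob J \<pi> j"
      "cat_prob J \<pi> j = tail_prob J \<pi> j - tail_prob J \<pi> (Suc j)"
    using assms tail_prob_pos[of \<pi> J j] tail_prob_Suc[of j J \<pi>] by auto
  ultimately show ?thesis by (simp add: diff_divide_distrib)
qed

lemma cumulative_ratio_pos:
  "\<pi> \<in> prob_simplex J \<Longrightarrow> j < J - 1 \<Longrightarrow> 0 < cumulative_ratio J \<pi> $ j"
  by (auto simp: cumulative_ratio_def intro!: sum_pos cat_prob_pos)

lemma sequential_ratio_pos:
  "\<pi> \<in> prob_simplex J \<Longrightarrow> j < J - 1 \<Longrightarrow> 0 < sequential_ratio J \<pi> $ j"
  using tail_prob_pos[of \<pi> J j] cat_prob_pos[of \<pi> J j]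
  by (simp add: sequential_ratio_def tail_prob_def)

text \<open>From the common start, equal quotients carry equality from each term to the next: once
  the denominators agree, the nonzero \<open>g j\<close> cancels.\<close>

lemma telescoping_ratios_iff:
  fixes f g :: "nat \<Rightarrow> 'a::field"
  assumes "f 0 = g 0" "\<And>j. j < n \<Longrightarrow> f j \<noteq> 0" "\<And>j. g j \<noteq> 0"
  shows "(\<forall>j<n. f (Suc j) / f j = g (Suc j) / g j) \<longleftrightarrow> (\<forall>j<n. f (Suc j) = g (Suc j))"
proof
  assume ratios: "\<forall>j<n. f (Suc j) / f j = g (Suc j) / g j"
  have "f j = g j" if "j \<le> n" for j
    using that
  proof (induction j)
    case (Suc j)
    then have "f j = g j" by simp
    moreover have "f (Suc j) / f j = g (Suc j) / g j" using ratios Suc.prems by (metis Suc_le_lessD)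
    ultimately show ?case using assms(3)[of j] by simp
  qed (use assms(1) in simp)
  then show "\<forall>j<n. f (Suc j) = g (Suc j)" by simp
next
  assume eq: "\<forall>j<n. f (Suc j) = g (Suc j)"
  \<comment> \<open>Equality is given at successors only; index 0 comes from the common
    start.\<close>
  have "f j = g j" if "j < n" for j
    using that assms(1) eq by (cases j) auto
  with eq show "\<forall>j<n. f (Suc j) / f j = g (Suc j) / g j" by simp
qed

text \<open>Row 0 has no subdiagonal entry, which amounts to putting a 0 in front of \<eta> and
  taking first differences.\<close>

lemma diff_mat_mult_vec:
  assumes "\<eta> \<in> carrier_vec (J - 1)" "j < J - 1"
  shows "(diff_mat J *\<^sub>v \<eta>) $ j = \<eta> $ j - (case j of 0 \<Rightarrow> 0 | Suc i \<Rightarrow> \<eta> $ i)"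
proof -
  have "(diff_mat J *\<^sub>v \<eta>) $ j
      = (\<Sum>k<J-1. (if k = j then \<eta> $ k else 0) - (if j = Suc k then \<eta> $ k else 0))"
    using assms by (auto simp: diff_mat_def scalar_prod_def atLeast0LessThan intro!: sum.cong)
  also have "\<dots> = \<eta> $ j - (\<Sum>k<J-1. if j = Suc k then \<eta> $ k else 0)"
    using assms(2) by (simp add: sum_subtractf)
  also have "(\<Sum>k<J-1. if j = Suc k then \<eta> $ k else 0) = (case j of 0 \<Rightarrow> 0 | Suc i \<Rightarrow> \<eta> $ i)"
    using assms(2) by (cases j) auto
  finally show ?thesis .
qed

text \<open>Stated for each \<pi> separately, so that it transfers both the solvability of the
  defining equations and their solutions between the two models.\<close>

lemma sequential_eq_iff_cumulative_eq:
  assumes "\<pi> \<in> prob_simplex J" "\<eta> \<in> carrier_vec (J - 1)" "0 < J"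
  shows "sequential_ratio J \<pi> = map_vec (fst exponential) (diff_mat J *\<^sub>v \<eta>) \<longleftrightarrow>
    cumulative_ratio J \<pi> = map_vec (fst exponential) \<eta>"
proof -
  \<comment> \<open>The index is shifted so that \<open>E\<close> lines up with the tail
    probabilities: \<open>E 0 = 1\<close> matches S_0, and \<open>E (Suc i)\<close> is the value
    that the cumulative model prescribes for S_(i+1).\<close>
  define E where "E j = exp (- (case j of 0 \<Rightarrow> 0 | Suc i \<Rightarrow> \<eta> $ i))" for j
  let ?S = "tail_prob J \<pi>"
  have dims: "dim_vec \<eta> = J - 1" "dim_vec (diff_mat J *\<^sub>v \<eta>) = J - 1"
    "dim_vec (sequential_ratio J \<pi>) = J - 1" "dim_vec (cumulative_ratio J \<pi>) = J - 1"
    using assms by (auto simp: diff_mat_def sequential_ratio_def cumulative_ratio_def)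
  have E_diff: "exp (- (diff_mat J *\<^sub>v \<eta>) $ j) = E (Suc j) / E j" if "j < J - 1" for j
    using diff_mat_mult_vec[OF assms(2) that] by (simp add: E_def flip: exp_diff)
  have "sequential_ratio J \<pi> = map_vec (fst exponential) (diff_mat J *\<^sub>v \<eta>) \<longleftrightarrow>
      (\<forall>j<J-1. ?S (Suc j) / ?S j = E (Suc j) / E j)"
    using assms(1) dims E_diff by (auto simp: vec_eq_iff exponential_def sequential_ratio_tail)
  also have "\<dots> \<longleftrightarrow> (\<forall>j<J-1. ?S (Suc j) = E (Suc j))"
  proof (rule telescoping_ratios_iff)
    show "?S 0 = E 0" using assms(3) by (simp add: tail_prob_0 E_def)
    show "?S j \<noteq> 0" if "j < J - 1" for j
    proof -
      have "j < J" using that by linarith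
      from tail_prob_pos[OF assms(1) this] show ?thesis by simp
    qed
  qed (simp add: E_def)
  also have "\<dots> \<longleftrightarrow> cumulative_ratio J \<pi> = map_vec (fst exponential) \<eta>"
    using dims by (auto simp: vec_eq_iff exponential_def cumulative_ratio_tail E_def)
  finally show ?thesis .
qed

text \<open>Membership in \<open>I\<^sub>F\<close> comes for free because both ratios are positive on the simplex.\<close>

lemma in_range_exponential_iff:
  assumes "cdf_fn m = exponential" "\<eta> \<in> carrier_vec (J - 1)"
    and "\<And>\<pi> j. \<pi> \<in> prob_simplex J \<Longrightarrow> j < J - 1 \<Longrightarrow> 0 < ratio m \<pi> $ j"
  shows "in_range J m \<eta> \<longleftrightarrow>
    (\<exists>\<pi>\<in>prob_simplex J. ratio m \<pi> = map_vec (fst exponential) \<eta>)"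
proof -
  have "0 < \<eta> $ j"
    if "\<pi> \<in> prob_simplex J" "ratio m \<pi> = map_vec (fst exponential) \<eta>" "j < J - 1" for \<pi> j
  proof -
    have "0 < 1 - exp (- \<eta> $ j)"
      using assms(2) assms(3)[OF that(1,3)] that(2,3) by (simp add: exponential_def)
    then show ?thesis by simp
  qed
  then have "\<eta> $ j \<in> snd exponential"
    if "\<pi> \<in> prob_simplex J" "ratio m \<pi> = map_vec (fst exponential) \<eta>" "j < J - 1" for \<pi> j
    using that by (simp add: exponential_def)
  moreover have "map_vec (fst exponential) \<eta> \<in> ratio m ` prob_simplex J \<longleftrightarrow>
      (\<exists>\<pi>\<in>prob_simplex J. ratio m \<pi> = map_vec (fst exponential) \<eta>)"
    unfolding image_iff by (simp only: eq_commute)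
  ultimately show ?thesis
    unfolding in_range_def assms(1) by blast
qed

theorem mainTheorem1:
  fixes J p q :: nat and X :: "real vec set" and Z :: "real vec \<Rightarrow> real mat"
  assumes "J \<ge> 3" and "p \<ge> 1"
    and "X \<subseteq> carrier_vec p" and "X \<noteq> {}"
    and "Z \<in> design_matrices J p X q"
  shows "models_equal J X
    \<lparr> ratio = cumulative_ratio J, cdf_fn = exponential, design = Z, num_cols = q \<rparr>
    \<lparr> ratio = sequential_ratio J, cdf_fn = exponential,
      design = (\<lambda>x. diff_mat J * Z x), num_cols = q \<rparr>"
    (is "models_equal J X ?C ?S")
proof -
  have Z: "Z x \<in> carrier_mat (J - 1) q" if "x \<in> X" for x
    using assms(5) that by (auto simp: design_matrices_def complete_design_def)
  have A: "diff_mat J \<in> carrier_mat (J - 1) (J - 1)"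
    by (simp add: diff_mat_def)
  have design: "design ?S x *\<^sub>v \<beta> = diff_mat J *\<^sub>v (Z x *\<^sub>v \<beta>)"
    if "x \<in> X" "\<beta> \<in> carrier_vec q" for x \<beta>
    using assoc_mult_mat_vec[OF A Z] that by simp
  have eta: "Z x *\<^sub>v \<beta> \<in> carrier_vec (J - 1)" if "x \<in> X" "\<beta> \<in> carrier_vec q" for x \<beta>
    using mult_mat_vec_carrier[OF Z] that by blast
  have ratio_iff: "ratio ?S \<pi> = map_vec (fst exponential) (design ?S x *\<^sub>v \<beta>) \<longleftrightarrow>
      ratio ?C \<pi> = map_vec (fst exponential) (design ?C x *\<^sub>v \<beta>)"
    if "x \<in> X" "\<beta> \<in> carrier_vec q" "\<pi> \<in> prob_simplex J" for x \<beta> \<pi>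
    using sequential_eq_iff_cumulative_eq[OF that(3) eta[OF that(1,2)]] design[OF that(1,2)]
      assms(1) by simp
  \<comment> \<open>Positivity of the ratios reduces each side to the existence of a solution in the
    simplex. For the sequential model this covers the condition that the entries of
    \<open>Z x *\<^sub>v \<beta>\<close> increase strictly from a positive first one.\<close>
  have "in_range J ?C (design ?C x *\<^sub>v \<beta>) \<longleftrightarrow> in_range J ?S (design ?S x *\<^sub>v \<beta>)"
    if "x \<in> X" "\<beta> \<in> carrier_vec q" for x \<beta>
  proof -
    have "in_range J ?C (design ?C x *\<^sub>v \<beta>) \<longleftrightarrow> (\<exists>\<pi>\<in>prob_simplex J.
        ratio ?C \<pi> = map_vec (fst exponential) (design ?C x *\<^sub>v \<beta>))"
      by (rule in_range_exponential_iff) (use eta[OF that] in \<open>simp_all add: cumulative_ratio_pos\<close>)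
    moreover have "in_range J ?S (design ?S x *\<^sub>v \<beta>) \<longleftrightarrow> (\<exists>\<pi>\<in>prob_simplex J.
        ratio ?S \<pi> = map_vec (fst exponential) (design ?S x *\<^sub>v \<beta>))"
      by (rule in_range_exponential_iff)
        (use mult_mat_vec_carrier[OF A eta[OF that]] design[OF that] in
          \<open>simp_all add: sequential_ratio_pos\<close>)
    ultimately show ?thesis using ratio_iff[OF that] by blast
  qed
  then have "param_space J X ?C = param_space J X ?S"
    by (auto simp: param_space_def)
  moreover have "model_prob J ?C x \<beta> = model_prob J ?S x \<beta>"
    if "x \<in> X" "\<beta> \<in> param_space J X ?C" for x \<beta>
  proof -
    have "\<beta> \<in> carrier_vec q" using that(2) by (simp add: param_space_def)
    \<comment> \<open>The predicates under the two \<open>THE\<close> operators hold for the same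
      \<pi>, so the described vectors coincide.\<close>
    from ratio_iff[OF that(1) this] show ?thesis
      unfolding model_prob_def by (intro arg_cong[where f = The] ext) auto
  qed
  ultimately show ?thesis unfolding models_equal_def by blast
qed

end
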